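(* Let $a,b,c\in\mathbb{R}$ and let $Q(x,y):=ax^2+2bxy+cy^2$ be the corresponding binary quadratic form in the variables $x$ and $y$. Then $Q(x,y)$ is nonnegative definite if and only if $a\ge 0$, $c\ge 0$ and $ac-b^2\ge 0$.
   Context: A real quadratic form $Q$ in $n$ variables is called nonnegative definite if $Q(\mathbf{x})\ge 0$ for all $\mathbf{x}\in\mathbb{R}^n$, $\mathbf{x}\neq\mathbf{0}$. *)

theory Defs
  imports "HOL-Analysis.Analysis"
begin

definition quadratic_form :: "(real ^ 'n \<Rightarrow> real) \<Rightarrow> bool" where
  "quadratic_form Q \<longleftrightarrow>
     (\<exists>A :: real ^ 'n ^ 'n. \<forall>x. Q x = (\<Sum>i\<in>UNIV. \<Sum>j\<in>UNIV. A $ i $ j * x $ i * x $ j))"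

definition nonnegative_definite :: "(real ^ 'n \<Rightarrow> real) \<Rightarrow> bool" where
  "nonnegative_definite Q \<longleftrightarrow> quadratic_form Q \<and> (\<forall>x. x \<noteq> 0 \<longrightarrow> Q x \<ge> 0)"

(* The variables x and y of the form are the components v $ 1 and v $ 2. *)
definition binary_form :: "real \<Rightarrow> real \<Rightarrow> real \<Rightarrow> real ^ 2 \<Rightarrow> real" where
  "binary_form a b c v = a * (v $ 1)\<^sup>2 + 2 * b * v $ 1 * v $ 2 + c * (v $ 2)\<^sup>2"

lemma quadratic_form_binary_form: "quadratic_form (binary_form a b c)"
  unfolding quadratic_form_def binary_form_def
  by (rule exI[of _ "vector [vector [a, b], vector [b, c]]"])
     (simp add: sum_2 power2_eq_square algebra_simps)

end

theory Submission
  imports Defs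
begin

text \<open>Completing the square gives a*Q(x,y) = (a*x + b*y)^2 + (a*c - b^2)*y^2, which settles
  sufficiency when a > 0. Conversely, evaluating Q at well-chosen vectors forces each inequality.
  Dividing by a needs a \<noteq> 0, so both directions treat a = 0 separately; there the determinant
  condition just says b = 0.\<close>

theorem proposition2p1:
  fixes a b c :: real
  shows "nonnegative_definite (binary_form a b c) \<longleftrightarrow> a \<ge> 0 \<and> c \<ge> 0 \<and> a * c - b\<^sup>2 \<ge> 0"
proof
  assume "nonnegative_definite (binary_form a b c)"
  then have nonneg: "binary_form a b c v \<ge> 0" for v
    by (cases "v = 0") (auto simp: nonnegative_definite_def binary_form_def)
  have a: "a \<ge> 0"
    using nonneg[of "vector [1, 0]"] by (simp add: binary_form_def)
  have c: "c \<ge> 0"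
    using nonneg[of "vector [0, 1]"] by (simp add: binary_form_def)
  have "a * c - b\<^sup>2 \<ge> 0"
  proof (cases "a = 0")
    case True
    \<comment> \<open>With a = 0, Q is linear in x, so a large enough x of sign opposite to b*y
      makes it negative unless b = 0. At (c + 1, -b) its value is -b^2*(c + 2).\<close>
    have "b\<^sup>2 * (c + 2) \<le> 0"
      using nonneg[of "vector [c + 1, - b]"] True
      by (simp add: binary_form_def algebra_simps power2_eq_square)
    with c True show ?thesis
      by (simp add: mult_le_0_iff)
  next
    case False
    \<comment> \<open>The vector (b, -a) annihilates the square (a*x + b*y)^2, leaving only the
      determinant term.\<close>
    have "a * (a * c - b\<^sup>2) \<ge> 0"
      using nonneg[of "vector [b, - a]"]
      by (simp add: binary_form_def algebra_simps power2_eq_square)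
    with a False show ?thesis
      by (simp add: zero_le_mult_iff)
  qed
  with a c show "a \<ge> 0 \<and> c \<ge> 0 \<and> a * c - b\<^sup>2 \<ge> 0"
    by blast
next
  assume asm: "a \<ge> 0 \<and> c \<ge> 0 \<and> a * c - b\<^sup>2 \<ge> 0"
  have "binary_form a b c v \<ge> 0" for v
  proof (cases "a = 0")
    case True
    \<comment> \<open>Here -b^2 \<ge> 0 forces b = 0, and only the term c*y^2 remains.\<close>
    with asm show ?thesis
      by (simp add: binary_form_def)
  next
    case False
    have "a * binary_form a b c v = (a * v $ 1 + b * v $ 2)\<^sup>2 + (a * c - b\<^sup>2) * (v $ 2)\<^sup>2"
      by (simp add: binary_form_def algebra_simps power2_eq_square)
    also have "\<dots> \<ge> 0"
      using asm by simp
    finally show ?thesis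
      using asm False by (simp add: zero_le_mult_iff)
  qed
  then show "nonnegative_definite (binary_form a b c)"
    by (simp add: nonnegative_definite_def quadratic_form_binary_form)
qed

end
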